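(* Let $q(x,y) = a x^2 + b x y + c y^2 + d x + e y + f \in \mathbb{Z}[x,y]$. Define $\mathbb{Q}(q)$ to be the set of all $\alpha = q(x,y)$ with $x,y \in \mathbb{Q}$ such that $\mathrm{Disc}(q) \cdot \alpha \neq \mathrm{Det}(q)$, and assume that $\mathbb{Q}(q)$ is nonempty. Then the map defined for $\alpha, \beta, \gamma \in \mathbb{Q}(q)$ by $$\alpha \cdot \beta^* \cdot \gamma = \frac{\mathrm{Disc}(q)\,\alpha\,\gamma - \mathrm{Det}(q)\,(\alpha - \beta + \gamma)}{\mathrm{Disc}(q)\,\beta - \mathrm{Det}(q)}$$ turns $\mathbb{Q}(q)$ into a commutative ternary group.
   Context: For $q(x,y) = a x^2 + b x y + c y^2 + d x + e y + f$, $$\mathrm{Det}(q) = \begin{vmatrix} a & b/2 & d/2 \\ b/2 & c & e/2 \\ d/2 & e/2 & f \end{vmatrix}, \qquad \mathrm{Disc}(q) = \begin{vmatrix} a & b/2 \\ b/2 & c \end{vmatrix}.$$ The paper uses "binary quadratic form" for such a general (possibly inhomogeneous) polynomial $q$. A set $\mathcal{C}$ is a commutative ternary group under a triple product $(P,Q,R) \mapsto P \cdot Q^* \cdot R$ (here $Q^*$ is only part of the notation) if for all $P,Q,R,S,T \in \mathcal{C}$: (1) (Multiplication) $P \cdot Q^* \cdot R \in \mathcal{C}$; (2) (Commutativity) $P \cdot Q^* \cdot R = R \cdot Q^* \cdot P$; (3) (Associativity) $(P \cdot Q^* \cdot R) \cdot S^* \cdot T = P \cdot Q^* \cdot (R \cdot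 S^* \cdot T)$; and there exist $Q_0, R_0 \in \mathcal{C}$ such that (4) (Identity) $P \cdot Q_0^* \cdot R_0 = P$ for all $P \in \mathcal{C}$; (5) (Inverses) for every $P \in \mathcal{C}$ there is $R \in \mathcal{C}$ with $P \cdot Q_0^* \cdot R = R_0$. *)

theory Defs
  imports "HOL-Analysis.Determinants"
begin

text \<open>
  \<open>Quad a b c d e f\<close> stands for the integral polynomial
  \<open>a x\<^sup>2 + b x y + c y\<^sup>2 + d x + e y + f\<close>. All coefficients are arbitrary,
  so the total degree may be smaller than 2.
\<close>
datatype quad_poly = Quad int int int int int int

fun eval_quad :: "quad_poly \<Rightarrow> rat \<Rightarrow> rat \<Rightarrow> rat" where
  "eval_quad (Quad a b c d e f) x y =
     of_int a * x\<^sup>2 + of_int b * x * y + of_int c * y\<^sup>2 + of_int d * x + of_int e * y + of_int f"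

fun Det_quad :: "quad_poly \<Rightarrow> rat" where
  "Det_quad (Quad a b c d e f) =
     det (vector [vector [of_int a,     of_int b / 2, of_int d / 2],
                  vector [of_int b / 2, of_int c,     of_int e / 2],
                  vector [of_int d / 2, of_int e / 2, of_int f    ]] :: rat^3^3)"

fun Disc_quad :: "quad_poly \<Rightarrow> rat" where
  "Disc_quad (Quad a b c d e f) =
     det (vector [vector [of_int a,     of_int b / 2],
                  vector [of_int b / 2, of_int c    ]] :: rat^2^2)"

definition rat_values :: "quad_poly \<Rightarrow> rat set" where
  "rat_values q = {\<alpha>. (\<exists>x y. \<alpha> = eval_quad q x y) \<and> Disc_quad q * \<alpha> \<noteq> Det_quad q}"

text \<open>The denominator is nonzero whenever \<open>\<beta> \<in> rat_values q\<close>.\<close>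
definition quad_triple :: "quad_poly \<Rightarrow> rat \<Rightarrow> rat \<Rightarrow> rat \<Rightarrow> rat" where
  "quad_triple q \<alpha> \<beta> \<gamma> =
     (Disc_quad q * \<alpha> * \<gamma> - Det_quad q * (\<alpha> - \<beta> + \<gamma>)) / (Disc_quad q * \<beta> - Det_quad q)"

text \<open>\<open>t P Q R\<close> is the triple product \<open>P \<cdot> Q\<^sup>* \<cdot> R\<close>.\<close>
locale comm_ternary_group =
  fixes C :: "'a set" and t :: "'a \<Rightarrow> 'a \<Rightarrow> 'a \<Rightarrow> 'a"
  assumes closed: "\<lbrakk>P \<in> C; Q \<in> C; R \<in> C\<rbrakk> \<Longrightarrow> t P Q R \<in> C"
    and commute: "\<lbrakk>P \<in> C; Q \<in> C; R \<in> C\<rbrakk> \<Longrightarrow> t P Q R = t R Q P"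
    and assoc: "\<lbrakk>P \<in> C; Q \<in> C; R \<in> C; S \<in> C; T \<in> C\<rbrakk> \<Longrightarrow> t (t P Q R) S T = t P Q (t R S T)"
    and identity_inverse:
      "\<exists>Q0\<in>C. \<exists>R0\<in>C. (\<forall>P\<in>C. t P Q0 R0 = P) \<and> (\<forall>P\<in>C. \<exists>R\<in>C. t P Q0 R = R0)"

end

theory Submission
  imports Defs
begin

text \<open>
  Put \<open>u \<alpha> = Disc q * \<alpha> - Det q\<close>. The triple product satisfies \<open>u (\<alpha> \<cdot> \<beta>\<^sup>* \<cdot> \<gamma>) = u \<alpha> * u \<gamma> / u \<beta>\<close>,
  which makes every axiom except closure a rational-function identity. If \<open>Disc q \<noteq> 0\<close>, translating
  to the centre of the conic gives \<open>\<alpha> = Q(X, Y) + Det q / Disc q\<close> with \<open>Q\<close> the homogeneous quadratic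
  part, and closure follows from the fact that the product of three values of \<open>Q\<close> is a value of \<open>Q\<close>,
  applied to \<open>\<alpha> \<gamma> / \<beta> = \<alpha> \<beta> \<gamma> / \<beta>\<^sup>2\<close>. If \<open>Disc q = 0 \<noteq> Det q\<close>, the conic is a parabola and \<open>q\<close>
  represents every rational number, being linear and nonconstant along the axis direction.
\<close>

lemma Disc_quad_eq: "Disc_quad (Quad a b c d e f) = of_int a * of_int c - (of_int b)\<^sup>2 / 4"
  by (simp add: det_2 power2_eq_square)

text \<open>Split as the discriminant times the constant term plus a remainder: the remainder is
  what survives when the discriminant vanishes, and what is divided by it in the value at the
  centre.\<close>

lemma Det_quad_eq:
  "Det_quad (Quad a b c d e f) =
     (of_int a * of_int c - (of_int b)\<^sup>2 / 4) * of_int f +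
     (of_int b * of_int d * of_int e - of_int a * (of_int e)\<^sup>2 - of_int c * (of_int d)\<^sup>2) / 4"
  by (simp add: det_3 power2_eq_square field_simps)

definition quad_form :: "'a::field \<Rightarrow> 'a \<Rightarrow> 'a \<Rightarrow> 'a \<Rightarrow> 'a \<Rightarrow> 'a" where
  "quad_form a b c x y = a * x\<^sup>2 + b * x * y + c * y\<^sup>2"

text \<open>
  For \<open>t\<^sup>2 = b t - a c\<close> the norm of \<open>a x + t y\<close> is \<open>a * quad_form a b c x y\<close>. The witness is
  \<open>\<omega>\<^sub>1 * conj \<omega>\<^sub>2 * \<omega>\<^sub>3 / a\<close> expanded in the basis \<open>a, t\<close>, where \<open>conj \<omega>\<^sub>2 * \<omega>\<^sub>3 / a = p + t r\<close>.
\<close>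
lemma quad_form_triple_product:
  fixes a b c :: "'a::field"
  shows "\<exists>x y. quad_form a b c x1 y1 * quad_form a b c x2 y2 * quad_form a b c x3 y3 =
    quad_form a b c x y"
proof -
  define p r where "p = a * x2 * x3 + b * y2 * x3 + c * y2 * y3" and "r = x2 * y3 - y2 * x3"
  have "quad_form a b c x2 y2 * quad_form a b c x3 y3 = p\<^sup>2 + b * p * r + a * c * r\<^sup>2"
    unfolding p_def r_def quad_form_def by algebra
  moreover have "quad_form a b c x1 y1 * (p\<^sup>2 + b * p * r + a * c * r\<^sup>2) =
      quad_form a b c (x1 * p - c * y1 * r) (a * x1 * r + y1 * p + b * y1 * r)"
    unfolding quad_form_def by algebra
  ultimately show ?thesis by (metis mult.assoc)
qed

lemma quad_form_triple_quotient:
  fixes a b c :: "'a::field"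
  assumes "quad_form a b c x2 y2 \<noteq> 0"
  shows "\<exists>x y. quad_form a b c x1 y1 * quad_form a b c x3 y3 / quad_form a b c x2 y2 =
    quad_form a b c x y"
proof -
  let ?k = "quad_form a b c x2 y2"
  obtain x y where xy: "quad_form a b c x1 y1 * ?k * quad_form a b c x3 y3 = quad_form a b c x y"
    using quad_form_triple_product by blast
  \<comment> \<open>Homogeneity of degree 2: scaling the arguments by \<open>1 / ?k\<close> turns
    the extra factor \<open>?k\<close> into a divisor.\<close>
  have "quad_form a b c (x / ?k) (y / ?k) = quad_form a b c x y / ?k\<^sup>2"
    by (simp add: quad_form_def [of _ _ _ "_ / _"] quad_form_def [of _ _ _ x y] power_divide
        add_divide_distrib power2_eq_square [of ?k])
  also have "\<dots> = quad_form a b c x1 y1 * quad_form a b c x3 y3 / ?k"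
    using assms by (simp add: xy [symmetric] power2_eq_square)
  finally show ?thesis by metis
qed

lemma eval_quad_centred:
  fixes a b c d e f :: int
  defines "q \<equiv> Quad a b c d e f"
  assumes "Disc_quad q \<noteq> 0"
  obtains x0 y0 where "\<And>x y. eval_quad q (x + x0) (y + y0) =
    quad_form (of_int a) (of_int b) (of_int c) x y + Det_quad q / Disc_quad q"
proof -
  define A B C D E F :: rat where
    "A = of_int a" and "B = of_int b" and "C = of_int c" and
    "D = of_int d" and "E = of_int e" and "F = of_int f"
  note defs = A_def B_def C_def D_def E_def F_def
  define k where "k = 4 * A * C - B\<^sup>2"
  have disc: "Disc_quad q = k / 4"
    unfolding q_def Disc_quad_eq k_def defs by simp
  hence k: "k \<noteq> 0" using assms by simp
  have det: "Det_quad q / Disc_quad q = F + (B * D * E - A * E\<^sup>2 - C * D\<^sup>2) / k"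
    using k unfolding disc unfolding q_def Det_quad_eq defs [symmetric]
    by (simp add: k_def field_simps)
  \<comment> \<open>The centre of the conic: Cramer's rule for the vanishing of both partial
    derivatives, which \<open>lin\<close> confirms.\<close>
  define x0 y0 where "x0 = (B * E - 2 * C * D) / k" and "y0 = (B * D - 2 * A * E) / k"
  have lin: "2 * A * x0 + B * y0 + D = 0" "B * x0 + 2 * C * y0 + E = 0"
    using k unfolding x0_def y0_def
    by (simp_all add: divide_simps) (simp_all add: k_def algebra_simps power2_eq_square)
  have const: "D * x0 + E * y0 = 2 * ((B * D * E - A * E\<^sup>2 - C * D\<^sup>2) / k)"
    unfolding x0_def y0_def
    by (simp add: add_divide_distrib [symmetric]) (simp add: algebra_simps power2_eq_square)
  have "eval_quad q (x + x0) (y + y0) = quad_form A B C x y + Det_quad q / Disc_quad q" for x y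
  proof -
    \<comment> \<open>Doubled Taylor expansion at the centre, with Euler's relation rewriting the
      value there so that the partial derivatives appear as factors.\<close>
    have "2 * eval_quad q (x + x0) (y + y0) =
        2 * quad_form A B C x y + (2 * x + x0) * (2 * A * x0 + B * y0 + D)
        + (2 * y + y0) * (B * x0 + 2 * C * y0 + E) + (D * x0 + E * y0) + 2 * F"
      unfolding q_def eval_quad.simps quad_form_def defs [symmetric]
      by (simp add: algebra_simps power2_eq_square)
    thus ?thesis unfolding lin const det by linarith
  qed
  thus ?thesis using that unfolding defs by blast
qed

lemma eval_quad_surj:
  fixes a b c d e f :: int
  defines "q \<equiv> Quad a b c d e f"
  assumes disc: "Disc_quad q = 0" and det: "Det_quad q \<noteq> 0"
  shows "\<exists>x y. \<alpha> = eval_quad q x y"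
proof -
  define A B C D E F :: rat where
    "A = of_int a" and "B = of_int b" and "C = of_int c" and
    "D = of_int d" and "E = of_int e" and "F = of_int f"
  note defs = A_def B_def C_def D_def E_def F_def
  have AC: "4 * A * C = B\<^sup>2"
    using disc unfolding q_def Disc_quad_eq defs by simp
  have nz: "B * D * E - A * E\<^sup>2 - C * D\<^sup>2 \<noteq> 0"
    using det AC unfolding q_def Det_quad_eq defs [symmetric] by auto
  have ev: "eval_quad q x y = A * x\<^sup>2 + B * x * y + C * y\<^sup>2 + D * x + E * y + F" for x y
    unfolding q_def eval_quad.simps defs by simp
  \<comment> \<open>By \<open>AC\<close>, the quadratic part vanishes along (B, -2A) and (2C, -B).
    The brackets are the slopes of the linear part in these directions, so \<open>nz\<close> makes
    one of them nonconstant.\<close>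
  have "2 * (B * D * E - A * E\<^sup>2 - C * D\<^sup>2) = E * (B * D - 2 * A * E) - D * (2 * C * D - B * E)"
    by (simp add: algebra_simps power2_eq_square)
  then consider "B * D - 2 * A * E \<noteq> 0" | "2 * C * D - B * E \<noteq> 0"
    using nz by force
  thus ?thesis
  proof cases
    case 1
    define s where "s = (\<alpha> - F) / (B * D - 2 * A * E)"
    have "s * (B * D - 2 * A * E) = \<alpha> - F" using 1 by (simp add: s_def)
    hence "\<alpha> = eval_quad q (s * B) (s * (- 2 * A))" unfolding ev using AC by algebra
    thus ?thesis by blast
  next
    case 2
    define s where "s = (\<alpha> - F) / (2 * C * D - B * E)"
    have "s * (2 * C * D - B * E) = \<alpha> - F" using 2 by (simp add: s_def)
    hence "\<alpha> = eval_quad q (s * (2 * C)) (s * (- B))" unfolding ev using AC by algebra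
    thus ?thesis by blast
  qed
qed

lemma quad_triple_mult:
  assumes "Disc_quad q * \<beta> \<noteq> Det_quad q"
  shows "Disc_quad q * quad_triple q \<alpha> \<beta> \<gamma> - Det_quad q =
    (Disc_quad q * \<alpha> - Det_quad q) * (Disc_quad q * \<gamma> - Det_quad q) / (Disc_quad q * \<beta> - Det_quad q)"
  using assms unfolding quad_triple_def
  by (simp add: divide_simps) (simp add: algebra_simps)

lemma quad_triple_commute: "quad_triple q \<alpha> \<beta> \<gamma> = quad_triple q \<gamma> \<beta> \<alpha>"
  by (simp add: quad_triple_def algebra_simps)

lemma quad_triple_cancel:
  assumes "Disc_quad q * \<beta> \<noteq> Det_quad q"
  shows "quad_triple q \<alpha> \<beta> \<beta> = \<alpha>"
  using assms by (simp add: quad_triple_def divide_eq_eq) (simp add: algebra_simps)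

lemma quad_triple_assoc:
  assumes "Disc_quad q * \<beta> \<noteq> Det_quad q" "Disc_quad q * \<delta> \<noteq> Det_quad q"
  shows "quad_triple q (quad_triple q \<alpha> \<beta> \<gamma>) \<delta> \<epsilon> = quad_triple q \<alpha> \<beta> (quad_triple q \<gamma> \<delta> \<epsilon>)"
proof -
  define D E where "D = Disc_quad q" and "E = Det_quad q"
  define t t' where "t = quad_triple q \<alpha> \<beta> \<gamma>" and "t' = quad_triple q \<gamma> \<delta> \<epsilon>"
  have nz: "D * \<beta> - E \<noteq> 0" "D * \<delta> - E \<noteq> 0" using assms by (simp_all add: D_def E_def)
  have t: "t * (D * \<beta> - E) = D * \<alpha> * \<gamma> - E * (\<alpha> - \<beta> + \<gamma>)"
    and t': "t' * (D * \<delta> - E) = D * \<gamma> * \<epsilon> - E * (\<gamma> - \<delta> + \<epsilon>)"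
    using nz by (simp_all add: t_def t'_def quad_triple_def D_def E_def)
  \<comment> \<open>Keeping \<open>t\<close> and \<open>t'\<close> opaque leaves a polynomial
    consequence of their defining equations, free of division.\<close>
  have "(D * t * \<epsilon> - E * (t - \<delta> + \<epsilon>)) * (D * \<beta> - E) = (D * \<alpha> * t' - E * (\<alpha> - \<beta> + t')) * (D * \<delta> - E)"
    using t t' by algebra
  hence "(D * t * \<epsilon> - E * (t - \<delta> + \<epsilon>)) / (D * \<delta> - E) = (D * \<alpha> * t' - E * (\<alpha> - \<beta> + t')) / (D * \<beta> - E)"
    using nz by (simp add: frac_eq_eq)
  thus ?thesis
    unfolding t_def [symmetric] t'_def [symmetric]
    by (simp add: quad_triple_def D_def E_def)
qed

lemma rat_valuesD: "\<alpha> \<in> rat_values q \<Longrightarrow> Disc_quad q * \<alpha> \<noteq> Det_quad q"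
  by (simp add: rat_values_def)

lemma quad_triple_closed:
  assumes "\<alpha> \<in> rat_values q" "\<beta> \<in> rat_values q" "\<gamma> \<in> rat_values q"
  shows "quad_triple q \<alpha> \<beta> \<gamma> \<in> rat_values q"
proof -
  obtain a b c d e f where q: "q = Quad a b c d e f" by (cases q)
  let ?D = "Disc_quad q" and ?E = "Det_quad q" and ?t = "quad_triple q \<alpha> \<beta> \<gamma>"
  note nz = assms [THEN rat_valuesD]
  note mult = quad_triple_mult [OF nz(2), of \<alpha> \<gamma>]
  have "?D * ?t - ?E \<noteq> 0"
    unfolding mult using nz by simp
  moreover have "\<exists>x y. ?t = eval_quad q x y"
  proof (cases "?D = 0")
    case True
    with nz(1) show ?thesis unfolding q by (intro eval_quad_surj) auto
  next
    case False
    let ?Q = "quad_form (of_int a) (of_int b) (of_int c) :: rat \<Rightarrow> rat \<Rightarrow> rat"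
    obtain x0 y0 where centre: "\<And>x y. eval_quad q (x + x0) (y + y0) = ?Q x y + ?E / ?D"
      using eval_quad_centred False unfolding q by blast
    have centred_value: "\<exists>x y. ?D * \<delta> - ?E = ?D * ?Q x y" if "\<delta> \<in> rat_values q" for \<delta>
    proof -
      from that obtain x y where "\<delta> = eval_quad q ((x - x0) + x0) ((y - y0) + y0)"
        by (auto simp: rat_values_def)
      with False have "?D * \<delta> - ?E = ?D * ?Q (x - x0) (y - y0)"
        unfolding centre by (simp add: algebra_simps)
      thus ?thesis by blast
    qed
    obtain x1 y1 x2 y2 x3 y3 where v:
      "?D * \<alpha> - ?E = ?D * ?Q x1 y1" "?D * \<beta> - ?E = ?D * ?Q x2 y2" "?D * \<gamma> - ?E = ?D * ?Q x3 y3"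
      using assms centred_value by meson
    hence "?Q x2 y2 \<noteq> 0" using nz(2) by auto
    then obtain x y where xy: "?Q x1 y1 * ?Q x3 y3 / ?Q x2 y2 = ?Q x y"
      using quad_form_triple_quotient by blast
    \<comment> \<open>Each factor in \<open>v\<close> carries one \<open>?D\<close>; two in the
      numerator against one below leave exactly one.\<close>
    have "?D * ?t - ?E = ?D * ?Q x y"
      using False unfolding mult v xy [symmetric] by simp
    hence "?t = eval_quad q (x + x0) (y + y0)"
      using False unfolding centre by (simp add: field_simps)
    thus ?thesis by blast
  qed
  ultimately show ?thesis by (simp add: rat_values_def)
qed

theorem theorem4p3:
  fixes a b c d e f :: int and q :: quad_poly
  assumes "q = Quad a b c d e f"
    and "rat_values q \<noteq> {}"
  shows "comm_ternary_group (rat_values q) (quad_triple q)"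
proof
  from assms(2) obtain \<beta> where \<beta>: "\<beta> \<in> rat_values q" by blast
  \<comment> \<open>Any \<beta> serves as both \<open>Q0\<close> and \<open>R0\<close>.
    Reassociating gives \<open>t (t \<alpha> \<beta> \<beta>) \<alpha> \<beta> = t \<alpha> \<alpha>
    \<beta>\<close>, which is \<beta> by commuting and cancelling.\<close>
  have "quad_triple q \<alpha> \<beta> (quad_triple q \<beta> \<alpha> \<beta>) = \<beta>" if "\<alpha> \<in> rat_values q" for \<alpha>
    using that \<beta> by (metis quad_triple_assoc quad_triple_cancel quad_triple_commute rat_valuesD)
  thus "\<exists>Q0\<in>rat_values q. \<exists>R0\<in>rat_values q. (\<forall>P\<in>rat_values q. quad_triple q P Q0 R0 = P) \<and>
      (\<forall>P\<in>rat_values q. \<exists>R\<in>rat_values q. quad_triple q P Q0 R = R0)"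
    using \<beta> by (meson quad_triple_cancel quad_triple_closed rat_valuesD)
qed (simp_all add: quad_triple_closed quad_triple_assoc rat_valuesD, rule quad_triple_commute)

end
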